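(* Let $n\geq 3$ be an integer, let $k$ be an integer with $1\leq k\leq\frac{n}{2}$, and let $a,b$ be distinct odd positive integers less than $n$. Then $\mathrm{Ci}[2n,\{a,b\}]$ is isomorphic to $A[n,k]$ if and only if all three of the following hold: (i) $n$ is even and $k=2$; (ii) $\gcd(2n,a)=\gcd(2n,b)=1$; and (iii) $a+b=n$.
   Context: For distinct positive integers $a,b<n$, $\mathrm{Ci}[2n,\{a,b\}]$ denotes the quartic circulant graph with vertex set $\{x_1,\ldots,x_{2n}\}$ in which $x_i$ is adjacent to $x_{i+a},x_{i-a},x_{i+b},x_{i-b}$, indices taken modulo $2n$. For integers $n\geq 3$ and $1\leq k\leq \frac{n}{2}$, the accordion graph $A[n,k]$ is the 4-regular graph with vertex set $\{u_1,\ldots,u_n,v_1,\ldots,v_n\}$ such that $(u_1,\ldots,u_n)$ and $(v_1,\ldots,v_n)$ are $n$-cycles, $u_i$ is adjacent to $v_i$ and to $v_{i+k}$ for every $i\in\{1,\ldots,n\}$, indices taken modulo $n$ with residue system $\{1,\ldots,n\}$. *)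

theory Defs
  imports "Graph_Theory.Pair_Digraph" "Graph_Theory.Digraph_Isomorphism"
    "HOL-Number_Theory.Cong"
begin

text \<open>
  A finite simple graph is a \<open>pair_graph\<close> of the AFP entry Graph Theory: finite vertex
  set, no loops, no parallel arcs, symmetric arc relation. An undirected edge \<open>xy\<close> is
  the pair of arcs \<open>(x, y)\<close> and \<open>(y, x)\<close>. Graph isomorphism is the entry's
  \<open>digraph_iso\<close>; see \<open>digraph_iso_iff_adjacency\<close> below.
\<close>

text \<open>
  The vertex \<open>x\<^sub>i\<close> is represented by its index \<open>i\<close> in the residue system \<open>{1..m}\<close>.
\<close>

definition circulant_graph :: "nat \<Rightarrow> nat set \<Rightarrow> nat pair_pre_digraph" where
  "circulant_graph m S = \<lparr> pverts = {1..m},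
     parcs = {(i, j). i \<in> {1..m} \<and> j \<in> {1..m} \<and>
                (\<exists>s\<in>S. [j = i + s] (mod m) \<or> [i = j + s] (mod m))} \<rparr>"

datatype accordion_vertex = U nat | V nat

text \<open>Each edge of the accordion graph, listed with one of its two orientations.\<close>

definition accordion_edges :: "nat \<Rightarrow> nat \<Rightarrow> accordion_vertex rel" where
  "accordion_edges n k =
     {(U i, U j) | i j. i \<in> {1..n} \<and> j \<in> {1..n} \<and> [j = i + 1] (mod n)} \<union>
     {(V i, V j) | i j. i \<in> {1..n} \<and> j \<in> {1..n} \<and> [j = i + 1] (mod n)} \<union>
     {(U i, V i) | i. i \<in> {1..n}} \<union>
     {(U i, V j) | i j. i \<in> {1..n} \<and> j \<in> {1..n} \<and> [j = i + k] (mod n)}"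

definition accordion_graph :: "nat \<Rightarrow> nat \<Rightarrow> accordion_vertex pair_pre_digraph" where
  "accordion_graph n k = \<lparr> pverts = U ` {1..n} \<union> V ` {1..n},
     parcs = accordion_edges n k \<union> (accordion_edges n k)\<inverse> \<rparr>"

lemma pair_graph_circulant_graph:
  assumes "\<And>s. s \<in> S \<Longrightarrow> 0 < s \<and> s < m"
  shows "pair_graph (circulant_graph m S)"
proof
  show "finite (parcs (circulant_graph m S))"
    by (rule finite_subset[of _ "{1..m} \<times> {1..m}"]) (auto simp: circulant_graph_def)
  have "\<not> [i = i + s] (mod m)" if "s \<in> S" for i s
  proof
    assume "[i = i + s] (mod m)"
    then have "[i + s = i + 0] (mod m)" by (simp add: cong_sym)
    then have "[s = 0] (mod m)" by (simp only: cong_add_lcancel_nat)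
    then show False using assms[OF that] by (auto simp: cong_0_iff dest: dvd_imp_le)
  qed
  then show "fst e \<noteq> snd e" if "e \<in> parcs (circulant_graph m S)" for e
    using that by (auto simp: circulant_graph_def)
qed (auto simp: circulant_graph_def symmetric_def intro!: symI)

lemma pair_graph_accordion_graph:
  assumes "2 \<le> n"
  shows "pair_graph (accordion_graph n k)"
proof
  have "accordion_edges n k \<subseteq> pverts (accordion_graph n k) \<times> pverts (accordion_graph n k)"
    by (auto simp: accordion_edges_def accordion_graph_def)
  then have sub: "parcs (accordion_graph n k)
      \<subseteq> pverts (accordion_graph n k) \<times> pverts (accordion_graph n k)"
    by (auto simp: accordion_graph_def)
  show "finite (pverts (accordion_graph n k))"
    by (simp add: accordion_graph_def)
  then show "finite (parcs (accordion_graph n k))"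
    using sub by (meson finite_SigmaI finite_subset)
  show "fst e \<in> pverts (accordion_graph n k)" "snd e \<in> pverts (accordion_graph n k)"
    if "e \<in> parcs (accordion_graph n k)" for e
    using that sub by auto
  have "\<not> [i = i + 1] (mod n)" for i
  proof
    assume "[i = i + 1] (mod n)"
    then have "[i + 1 = i + 0] (mod n)" by (simp add: cong_sym)
    then have "[1 = 0] (mod n)" by (simp only: cong_add_lcancel_nat)
    then show False using assms by (auto simp: cong_0_iff)
  qed
  then show "fst e \<noteq> snd e" if "e \<in> parcs (accordion_graph n k)" for e
    using that by (auto simp: accordion_graph_def accordion_edges_def)
  show "symmetric (with_proj (accordion_graph n k))"
    by (auto simp: accordion_graph_def symmetric_def intro!: symI)
qed

lemma digraph_iso_iff_adjacency:
  assumes "pair_wf_digraph G" "pair_wf_digraph H"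
  shows "digraph_iso (with_proj G) (with_proj H) \<longleftrightarrow>
    (\<exists>f. bij_betw f (pverts G) (pverts H) \<and>
         (\<forall>x\<in>pverts G. \<forall>y\<in>pverts G. (f x, f y) \<in> parcs H \<longleftrightarrow> (x, y) \<in> parcs G))"
    (is "?L \<longleftrightarrow> ?R")
proof
  interpret G: pair_wf_digraph G by fact
  assume ?L
  then obtain h where h: "pre_digraph.digraph_isomorphism (with_proj G) h"
    and H: "with_proj H = app_iso h (with_proj G)"
    by (auto simp: digraph_iso_def)
  let ?f = "iso_verts h"
  have inj: "inj_on ?f (pverts G)"
    using h by (simp add: pre_digraph.digraph_isomorphism_def)
  have pv: "pverts H = ?f ` pverts G"
    using arg_cong[OF H, of verts] by simp
  have tl: "iso_tail h = fst" and hd: "iso_head h = snd"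
    using arg_cong[OF H, of tail] arg_cong[OF H, of head] by simp_all
  have arc: "iso_arcs h (x, y) = (?f x, ?f y)" if "(x, y) \<in> parcs G" for x y
    using h that tl hd by (fastforce simp: pre_digraph.digraph_isomorphism_def prod_eq_iff)
  have pa: "parcs H = iso_arcs h ` parcs G"
    using arg_cong[OF H, of arcs] by simp
  have "(?f x, ?f y) \<in> parcs H \<longleftrightarrow> (x, y) \<in> parcs G"
    if "x \<in> pverts G" "y \<in> pverts G" for x y
  proof
    assume "(?f x, ?f y) \<in> parcs H"
    then obtain a b where ab: "(a, b) \<in> parcs G" and "(?f x, ?f y) = iso_arcs h (a, b)"
      using pa by auto
    then have "?f x = ?f a" "?f y = ?f b" using arc by auto
    moreover have "a \<in> pverts G" "b \<in> pverts G" using ab by (auto dest: G.wellformed')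
    ultimately show "(x, y) \<in> parcs G" using inj that ab by (auto dest: inj_onD)
  next
    assume "(x, y) \<in> parcs G"
    then show "(?f x, ?f y) \<in> parcs H" using arc pa by (metis imageI)
  qed
  then show ?R using inj pv by (intro exI[of _ ?f]) (auto simp: bij_betw_def)
next
  interpret G: pair_wf_digraph G by fact
  interpret H: pair_wf_digraph H by fact
  assume ?R
  then obtain f where f: "bij_betw f (pverts G) (pverts H)"
    and adj: "\<And>x y. x \<in> pverts G \<Longrightarrow> y \<in> pverts G \<Longrightarrow>
      (f x, f y) \<in> parcs H \<longleftrightarrow> (x, y) \<in> parcs G"
    by blast
  let ?h = "\<lparr> iso_verts = f, iso_arcs = map_prod f f, iso_head = snd, iso_tail = fst \<rparr>"
  have inj: "inj_on f (pverts G)" and img: "f ` pverts G = pverts H"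
    using f by (auto simp: bij_betw_def)
  have "inj_on (map_prod f f) (parcs G)"
    by (rule inj_on_subset[OF map_prod_inj_on[OF inj inj]]) (auto dest: G.wellformed')
  then have 1: "pre_digraph.digraph_isomorphism (with_proj G) ?h"
    using inj G.wf_digraph_axioms by (auto simp: pre_digraph.digraph_isomorphism_def)
  have "map_prod f f ` parcs G = parcs H"
  proof (intro equalityI subsetI)
    fix e assume "e \<in> map_prod f f ` parcs G"
    then show "e \<in> parcs H" using adj by (auto dest: G.wellformed')
  next
    fix e assume e: "e \<in> parcs H"
    then have "fst e \<in> f ` pverts G" "snd e \<in> f ` pverts G"
      using img by (auto dest: H.arc_fst_in_verts H.arc_snd_in_verts)
    then obtain x y where xy: "x \<in> pverts G" "y \<in> pverts G" "e = (f x, f y)"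
      by (metis imageE prod.collapse)
    then have "(x, y) \<in> parcs G" using e adj by simp
    then show "e \<in> map_prod f f ` parcs G" using xy by force
  qed
  then have 2: "with_proj H = app_iso ?h (with_proj G)"
    using img by (simp add: with_proj_def app_iso_def)
  show ?L unfolding digraph_iso_def using 1 2 by blast
qed

end

theory Submission
  imports Defs
begin

text \<open>
  An isomorphism amounts to a labelling of the accordion graph by residues modulo \<open>2n\<close> in which
  adjacency means that the labels differ by \<open>\<plusminus>a\<close> or \<open>\<plusminus>b\<close>. As these are odd, the labels give a
  2-colouring; this excludes \<open>k = 1\<close> (a triangle) and odd \<open>n\<close> (the cycle of the \<open>u\<^sub>i\<close>).
  If \<open>k \<ge> 3\<close>, then \<open>u\<^sub>i\<^sub>+\<^sub>1\<close> is the only common neighbour of \<open>u\<^sub>i\<close> and \<open>u\<^sub>i\<^sub>+\<^sub>2\<close>. In the circulant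
  graph two consecutive steps \<open>s, t\<close> can be performed in the order \<open>t, s\<close>, so uniqueness forces
  \<open>s = t\<close>: the labels of the \<open>u\<^sub>i\<close> form an arithmetic progression with odd difference \<open>s\<close>, which
  closes up after \<open>n\<close> steps, contradicting \<open>2n \<nmid> ns\<close>. For \<open>k = 2\<close>, the vertices \<open>u\<^sub>i\<close> and
  \<open>v\<^sub>i\<^sub>+\<^sub>1\<close> have the same neighbours, so a nonzero translation preserves \<open>{\<plusminus>a, \<plusminus>b}\<close>, which forces
  \<open>a + b = n\<close>; the gcd conditions then express connectedness. Conversely, both graphs arise
  from an \<open>n\<close>-cycle by doubling every vertex.
\<close>

section \<open>Labellings by residues as inverse isomorphisms\<close>

text \<open>The inverse of an isomorphism from the circulant graph onto \<open>G\<close>, with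
  integer values that matter only modulo \<open>m\<close>: labels can then be added and subtracted
  without reducing them to \<open>{1..m}\<close>. The first conjunct is bijectivity onto the
  residues.\<close>

definition circulant_labelling ::
    "nat \<Rightarrow> nat set \<Rightarrow> 'a pair_pre_digraph \<Rightarrow> ('a \<Rightarrow> int) \<Rightarrow> bool" where
  "circulant_labelling m S G z \<longleftrightarrow>
     (\<forall>t. \<exists>!p. p \<in> pverts G \<and> [z p = t] (mod int m)) \<and>
     (\<forall>p\<in>pverts G. \<forall>q\<in>pverts G. (p, q) \<in> parcs G \<longleftrightarrow>
        (\<exists>s\<in>S. [z q - z p = int s] (mod int m) \<or> [z q - z p = - int s] (mod int m)))"

lemma circulant_arc_iff:
  "(i, j) \<in> parcs (circulant_graph m S) \<longleftrightarrow> i \<in> {1..m} \<and> j \<in> {1..m} \<and>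
     (\<exists>s\<in>S. [int j - int i = int s] (mod int m) \<or> [int j - int i = - int s] (mod int m))"
proof -
  have 1: "[j = i + s] (mod m) \<longleftrightarrow> [int j - int i = int s] (mod int m)" for s
    by (simp add: cong_iff_dvd_diff algebra_simps flip: cong_int_iff)
  have 2: "[i = j + s] (mod m) \<longleftrightarrow> [int j - int i = - int s] (mod int m)" for s
    unfolding cong_int_iff[symmetric] cong_iff_dvd_diff
    by (subst dvd_minus_iff[symmetric]) (simp add: algebra_simps)
  show ?thesis by (auto simp: circulant_graph_def 1 2)
qed

lemma pverts_circulant_graph [simp]: "pverts (circulant_graph m S) = {1..m}"
  by (simp add: circulant_graph_def)

lemma ex1_residue:
  assumes "0 < m"
  shows "\<exists>!i::nat. i \<in> {1..m} \<and> [int i = t] (mod int m)"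
proof (rule ex_ex1I)
  \<comment> \<open>The residue system starts at 1, so \<open>t - 1\<close> is reduced to
    \<open>{0..<m}\<close> and the result is raised by one.\<close>
  let ?r = "nat ((t - 1) mod int m)"
  have "?r < m" using assms by (simp add: nat_less_iff)
  moreover have "[int (Suc ?r) = t] (mod int m)"
    using assms by (simp add: cong_def mod_simps)
  ultimately show "\<exists>i::nat. i \<in> {1..m} \<and> [int i = t] (mod int m)"
    by (intro exI[of _ "Suc ?r"]) simp
next
  fix i j :: nat
  assume "i \<in> {1..m} \<and> [int i = t] (mod int m)" "j \<in> {1..m} \<and> [int j = t] (mod int m)"
  then have r: "i \<in> {1..m}" "j \<in> {1..m}" and "int m dvd int i - int j"
    by (auto simp flip: cong_iff_dvd_diff intro: cong_trans cong_sym)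
  moreover have "\<bar>int i - int j\<bar> < \<bar>int m\<bar>" using r by auto
  ultimately show "i = j" using zdvd_not_zless by (metis dvd_imp_le_int eq_iff_diff_eq_0 linorder_not_less of_nat_eq_iff)
qed

text \<open>An isomorphism \<open>f\<close> yields the labelling by its inverse. Conversely, a
  labelling yields the isomorphism that sends \<open>i\<close> to the unique vertex with label
  \<open>i\<close> modulo \<open>m\<close>.\<close>

lemma digraph_iso_circulant_iff:
  assumes G: "pair_wf_digraph G" and S: "\<And>s. s \<in> S \<Longrightarrow> 0 < s \<and> s < m" and "0 < m"
  shows "digraph_iso (with_proj (circulant_graph m S)) (with_proj G) \<longleftrightarrow>
    (\<exists>z. circulant_labelling m S G z)"
    (is "?L \<longleftrightarrow> ?R")
proof -
  interpret C: pair_graph "circulant_graph m S"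
    by (rule pair_graph_circulant_graph) (use S in auto)
  have iso: "?L \<longleftrightarrow> (\<exists>f. bij_betw f {1..m} (pverts G) \<and>
    (\<forall>x\<in>{1..m}. \<forall>y\<in>{1..m}. (f x, f y) \<in> parcs G \<longleftrightarrow> (x, y) \<in> parcs (circulant_graph m S)))"
    using digraph_iso_iff_adjacency[OF C.pair_wf_digraph_axioms G] by simp
  show ?thesis
  proof
    assume ?L
    then obtain f where f: "bij_betw f {1..m} (pverts G)"
      and adj: "\<And>x y. x \<in> {1..m} \<Longrightarrow> y \<in> {1..m} \<Longrightarrow>
        (f x, f y) \<in> parcs G \<longleftrightarrow> (x, y) \<in> parcs (circulant_graph m S)"
      using iso by blast
    define g where "g = inv_into {1..m} f"
    have g: "g p \<in> {1..m}" "f (g p) = p" if "p \<in> pverts G" for p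
      using that f unfolding g_def
      by (metis bij_betw_imp_surj_on inv_into_into, metis bij_betw_inv_into_right)
    have gf: "g (f i) = i" if "i \<in> {1..m}" for i
      using that f unfolding g_def by (metis bij_betw_inv_into_left)
    have "\<exists>!p. p \<in> pverts G \<and> [int (g p) = t] (mod int m)" for t
    proof -
      obtain i where i: "i \<in> {1..m}" "[int i = t] (mod int m)"
        using ex1_residue[OF \<open>0 < m\<close>] by blast
      show ?thesis
      proof (rule ex1I)
        show "f i \<in> pverts G \<and> [int (g (f i)) = t] (mod int m)"
          using i gf f by (auto simp: bij_betw_apply)
        show "p = f i" if "p \<in> pverts G \<and> [int (g p) = t] (mod int m)" for p
          using that ex1_residue[OF \<open>0 < m\<close>] i g by metis
      qed
    qed
    moreover have "(p, q) \<in> parcs G \<longleftrightarrow> (\<exists>s\<in>S. [int (g q) - int (g p) = int s] (mod int m)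
        \<or> [int (g q) - int (g p) = - int s] (mod int m))"
      if "p \<in> pverts G" "q \<in> pverts G" for p q
      using adj[of "g p" "g q"] g that circulant_arc_iff by simp
    ultimately have "circulant_labelling m S G (\<lambda>p. int (g p))"
      unfolding circulant_labelling_def by blast
    then show ?R by blast
  next
    assume ?R
    then obtain z where ex1: "\<And>t. \<exists>!p. p \<in> pverts G \<and> [z p = t] (mod int m)"
      and adj: "\<And>p q. p \<in> pverts G \<Longrightarrow> q \<in> pverts G \<Longrightarrow> (p, q) \<in> parcs G \<longleftrightarrow>
        (\<exists>s\<in>S. [z q - z p = int s] (mod int m) \<or> [z q - z p = - int s] (mod int m))"
      unfolding circulant_labelling_def by blast
    obtain f where f: "\<And>t. f t \<in> pverts G" "\<And>t. [z (f t) = t] (mod int m)"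
      using ex1 by metis
    have "bij_betw (\<lambda>i. f (int i)) {1..m} (pverts G)"
    proof (rule bij_betw_imageI)
      show "inj_on (\<lambda>i. f (int i)) {1..m}"
        by (rule inj_onI) (metis ex1_residue[OF \<open>0 < m\<close>] f(2) cong_sym)
      show "(\<lambda>i. f (int i)) ` {1..m} = pverts G"
      proof (intro equalityI subsetI)
        fix p assume p: "p \<in> pverts G"
        obtain i where "i \<in> {1..m}" "[int i = z p] (mod int m)"
          using ex1_residue[OF \<open>0 < m\<close>] by blast
        then show "p \<in> (\<lambda>i. f (int i)) ` {1..m}"
          using ex1 f p by (metis cong_refl cong_trans imageI)
      qed (use f(1) in blast)
    qed
    moreover have "(f (int i), f (int j)) \<in> parcs G \<longleftrightarrow> (i, j) \<in> parcs (circulant_graph m S)"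
      if "i \<in> {1..m}" "j \<in> {1..m}" for i j
    proof -
      have "[z (f (int j)) - z (f (int i)) = int j - int i] (mod int m)"
        by (intro cong_diff f)
      then have "[z (f (int j)) - z (f (int i)) = s] (mod int m) \<longleftrightarrow>
          [int j - int i = s] (mod int m)" for s
        by (metis cong_sym cong_trans)
      then show ?thesis using adj f(1) circulant_arc_iff that by simp
    qed
    ultimately show ?L using iso by blast
  qed
qed

section \<open>Adjacency in the accordion graph\<close>

lemma pverts_accordion_graph [simp]:
  "U i \<in> pverts (accordion_graph n k) \<longleftrightarrow> i \<in> {1..n}"
  "V i \<in> pverts (accordion_graph n k) \<longleftrightarrow> i \<in> {1..n}"
  by (auto simp: accordion_graph_def)

lemma accordion_arc_iff:
  assumes "i \<in> {1..n}" "j \<in> {1..n}"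
  shows "(U i, U j) \<in> parcs (accordion_graph n k) \<longleftrightarrow> [j = i + 1] (mod n) \<or> [i = j + 1] (mod n)"
    and "(V i, V j) \<in> parcs (accordion_graph n k) \<longleftrightarrow> [j = i + 1] (mod n) \<or> [i = j + 1] (mod n)"
    and "(U i, V j) \<in> parcs (accordion_graph n k) \<longleftrightarrow> [j = i] (mod n) \<or> [j = i + k] (mod n)"
    and "(V j, U i) \<in> parcs (accordion_graph n k) \<longleftrightarrow> [j = i] (mod n) \<or> [j = i + k] (mod n)"
proof -
  have "[j = i] (mod n) \<longleftrightarrow> j = i"
    using assms ex1_residue[of n "int i"] by (metis atLeastAtMost_iff cong_int_iff cong_refl gr0I not_one_le_zero le_zero_eq)
  then show "(U i, U j) \<in> parcs (accordion_graph n k) \<longleftrightarrow> [j = i + 1] (mod n) \<or> [i = j + 1] (mod n)"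
    "(V i, V j) \<in> parcs (accordion_graph n k) \<longleftrightarrow> [j = i + 1] (mod n) \<or> [i = j + 1] (mod n)"
    "(U i, V j) \<in> parcs (accordion_graph n k) \<longleftrightarrow> [j = i] (mod n) \<or> [j = i + k] (mod n)"
    "(V j, U i) \<in> parcs (accordion_graph n k) \<longleftrightarrow> [j = i] (mod n) \<or> [j = i + k] (mod n)"
    using assms by (auto simp: accordion_graph_def accordion_edges_def)
qed

lemma cong_nat_iff_dvd_int: "[i = j] (mod n) \<longleftrightarrow> int n dvd int i - int j"
  by (simp add: cong_iff_dvd_diff flip: cong_int_iff)

lemma dvd_int_smallE:
  fixes t m :: int
  assumes "m dvd t" "\<bar>t\<bar> < 2 * m"
  obtains "t = 0" | "t = m" | "t = - m"
proof -
  obtain c where c: "t = m * c" using assms by blast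
  have "0 < m" using assms by linarith
  then have "\<bar>c\<bar> < 2" using assms c by (simp add: abs_mult)
  then have "c = 0 \<or> c = 1 \<or> c = -1" by linarith
  then show thesis using that c by auto
qed

text \<open>Two rim neighbourhoods at distance 2 meet in a second \<open>U\<close> vertex only if 2
  or 4 vanishes modulo \<open>n\<close>, and in a \<open>V\<close> vertex only if one of 2,
  \<open>k - 2\<close>, \<open>k + 2\<close> does. The bounds on \<open>k\<close> give
  \<open>n \<ge> 6\<close> and exclude all of these.\<close>

lemma accordion_rim_common_neighbour:
  assumes k: "3 \<le> k" "2 * k \<le> n"
    and xyw: "x \<in> {1..n}" "y \<in> {1..n}" "w \<in> {1..n}" "[w = x + 1] (mod n)" "[y = w + 1] (mod n)"
    and p: "(U x, p) \<in> parcs (accordion_graph n k)" "(p, U y) \<in> parcs (accordion_graph n k)"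
      "p \<in> pverts (accordion_graph n k)"
  shows "p = U w"
proof -
  \<comment> \<open>The two sides differ by less than \<open>2 * n\<close>, so each congruence of
    indices becomes one of three linear equations, which suit \<open>linarith\<close>.\<close>
  have red: "i = j + d \<or> i = j + d + n \<or> i + n = j + d"
    if "[i = j + d] (mod n)" "i \<in> {1..n}" "j \<in> {1..n}" "d \<le> n" for i j d
  proof -
    have "int n dvd int i - int (j + d)" using that(1) by (simp only: cong_nat_iff_dvd_int)
    moreover have "\<bar>int i - int (j + d)\<bar> < 2 * int n" using that by auto
    ultimately show ?thesis by (elim dvd_int_smallE) auto
  qed
  have d: "1 \<le> n" "k \<le> n" "0 \<le> n" using k by auto
  have xy: "w = x + 1 \<or> w + n = x + 1" "y = w + 1 \<or> y + n = w + 1"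
    using red[OF xyw(4,3,1) d(1)] red[OF xyw(5,2,3) d(1)] xyw(1,2,3) by auto
  show ?thesis
  proof (cases p)
    case (U j)
    then have j: "j \<in> {1..n}" using p by simp
    have "[j = x + 1] (mod n) \<or> [x = j + 1] (mod n)" "[y = j + 1] (mod n) \<or> [j = y + 1] (mod n)"
      using p xyw j unfolding U by (simp_all add: accordion_arc_iff)
    then have "j = x + 1 \<or> j + n = x + 1 \<or> x = j + 1 \<or> x + n = j + 1"
      "j = y + 1 \<or> j + n = y + 1 \<or> y = j + 1 \<or> y + n = j + 1"
      using red[OF _ j xyw(1) d(1)] red[OF _ j xyw(2) d(1)] red[OF _ xyw(1) j d(1)]
        red[OF _ xyw(2) j d(1)] j xyw(1,2) by auto
    moreover have "6 \<le> n" "1 \<le> w" "w \<le> n" "1 \<le> j" "j \<le> n" using k xyw j by auto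
    ultimately have "j = w" using xy by (elim disjE; linarith)
    then show ?thesis using U by simp
  next
    case (V j)
    then have j: "j \<in> {1..n}" using p by simp
    have "[j = x + 0] (mod n) \<or> [j = x + k] (mod n)" "[j = y + 0] (mod n) \<or> [j = y + k] (mod n)"
      using p xyw j unfolding V by (simp_all add: accordion_arc_iff)
    then have "j = x \<or> j = x + k \<or> j + n = x + k" "j = y \<or> j = y + k \<or> j + n = y + k"
      using red[OF _ j xyw(1) d(2)] red[OF _ j xyw(2) d(2)] red[OF _ j xyw(1) d(3)]
        red[OF _ j xyw(2) d(3)] j xyw(1,2) by auto
    moreover have "6 \<le> n" "1 \<le> w" "w \<le> n" "1 \<le> j" "j \<le> n" using k xyw j by auto
    ultimately have False using xy k by (elim disjE; linarith)
    then show ?thesis ..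
  qed
qed

section \<open>Label differences along arcs, and translations of the connection set\<close>

lemma circulant_labelling_arc_shift:
  assumes "circulant_labelling m S G z" "(p, q) \<in> parcs G"
    and "p \<in> pverts G" "q \<in> pverts G" "p' \<in> pverts G" "q' \<in> pverts G"
    and "[z q' - z p' = z q - z p] (mod int m)"
  shows "(p', q') \<in> parcs G"
  using assms unfolding circulant_labelling_def by (meson cong_trans)

text \<open>Serves with \<open>d = 2\<close>, \<open>r = 1\<close> for the parity colouring, and
  with \<open>r = 0\<close> and a common divisor \<open>d\<close> of \<open>m\<close> and the steps
  for connectedness.\<close>

lemma circulant_labelling_arc_dvd:
  assumes z: "circulant_labelling m S G z" and d: "d dvd int m" "\<And>s. s \<in> S \<Longrightarrow> d dvd int s - r"
     "\<And>s. s \<in> S \<Longrightarrow> d dvd - int s - r"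
    and "(p, q) \<in> parcs G" "p \<in> pverts G" "q \<in> pverts G"
  shows "d dvd z q - z p - r"
proof -
  obtain s where s: "s \<in> S"
    "int m dvd (z q - z p) - int s \<or> int m dvd (z q - z p) - (- int s)"
    using assms unfolding circulant_labelling_def cong_iff_dvd_diff by blast
  then have "d dvd (z q - z p) - int s \<or> d dvd (z q - z p) - (- int s)"
    using d(1) dvd_trans by blast
  then show ?thesis
  proof
    assume "d dvd (z q - z p) - int s"
    from dvd_add[OF this d(2)[OF s(1)]] show ?thesis by (simp add: algebra_simps)
  next
    assume "d dvd (z q - z p) - (- int s)"
    from dvd_add[OF this d(3)[OF s(1)]] show ?thesis by (simp add: algebra_simps)
  qed
qed

text \<open>The translate of \<open>a\<close> is one of \<open>-a\<close>, \<open>b\<close>,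
  \<open>-b\<close>, which leaves three values for \<open>e\<close> modulo \<open>2 * n\<close>. In
  each case the translates of two further elements leave \<open>a + b = n\<close> as the only
  possibility.\<close>

lemma connection_set_translate:
  fixes a b n e :: int
  assumes ab: "0 < a" "a < n" "0 < b" "b < n" "a \<noteq> b" and e: "\<not> 2 * n dvd e"
    and tr: "\<And>c. c \<in> {a, -a, b, -b} \<Longrightarrow> \<exists>s\<in>{a, -a, b, -b}. 2 * n dvd c + e - s"
  shows "a + b = n"
proof -
  obtain s where s: "s \<in> {a, -a, b, -b}" "2 * n dvd a + e - s" using tr[of a] by blast
  \<comment> \<open>A small representative of \<open>e\<close>: it keeps \<open>c + e' - s\<close>
    strictly between \<open>-4 * n\<close> and \<open>4 * n\<close>, so divisibility by
    \<open>2 * n\<close> again means three equations.\<close>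
  define e' where "e' = s - a"
  have "s \<noteq> a" using s e by auto
  then have e': "e' \<in> {-2 * a, b - a, -a - b}" "2 * n dvd e - e'"
    using s by (auto simp: e'_def algebra_simps)
  have red: "\<exists>s\<in>{a, -a, b, -b}. c + e' - s = 0 \<or> c + e' - s = 2 * n \<or> c + e' - s = - 2 * n"
    if c: "c \<in> {a, -a, b, -b}" for c
  proof -
    obtain s where s: "s \<in> {a, -a, b, -b}" "2 * n dvd c + e - s" using tr[OF c] by blast
    have "2 * n dvd (c + e - s) - (e - e')" using s e' dvd_diff by blast
    then have "2 * n dvd c + e' - s" by (simp add: algebra_simps)
    moreover have "\<bar>c + e' - s\<bar> < 2 * (2 * n)" using c s(1) e'(1) ab by auto
    ultimately show ?thesis using s(1) by (elim dvd_int_smallE) auto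
  qed
  from e'(1) show ?thesis
  proof (elim insertE emptyE)
    assume "e' = -2 * a"
    then show ?thesis using red[of b] red[of "-b"] ab by (simp, elim disjE; linarith)
  next
    assume "e' = b - a"
    then show ?thesis using red[of "-a"] red[of b] ab by (simp, elim disjE; linarith)
  next
    assume "e' = - a - b"
    then show ?thesis using red[of "-a"] red[of "-b"] ab by (simp, elim disjE; linarith)
  qed
qed


section \<open>Walks around the rim: parity, the bound on \<open>k\<close>, common divisors\<close>

text \<open>The cycle of the \<open>U\<close> vertices as an \<open>n\<close>-periodic sequence
  starting at \<open>U 1\<close>, so that walks allow induction and close up through
  \<open>rim n n = rim n 0\<close>.\<close>

definition rim :: "nat \<Rightarrow> nat \<Rightarrow> accordion_vertex" where
  "rim n i = U (Suc (i mod n))"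

lemma rim_verts [simp]: "0 < n \<Longrightarrow> rim n i \<in> pverts (accordion_graph n k)"
  by (simp add: rim_def Suc_le_eq)

lemma rim_arc:
  assumes "0 < n"
  shows "(rim n i, rim n (Suc i)) \<in> parcs (accordion_graph n k)"
proof -
  have "[Suc (Suc i mod n) = Suc (i mod n) + 1] (mod n)" by (simp add: cong_def mod_simps)
  then show ?thesis using assms by (simp add: rim_def accordion_arc_iff Suc_le_eq)
qed

lemma even_order_if_odd_circulant_labelling:
  assumes z: "circulant_labelling m S (accordion_graph n k) z"
    and "0 < n" "even m" "\<And>s. s \<in> S \<Longrightarrow> odd s"
  shows "even n"
proof -
  have step: "2 dvd z (rim n (Suc i)) - z (rim n i) - 1" for i
    by (rule circulant_labelling_arc_dvd[OF z]) (use assms rim_arc in auto)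
  have "2 dvd z (rim n i) - z (rim n 0) - int i" for i
  proof (induction i)
    case (Suc i)
    from dvd_add[OF Suc step[of i]] show ?case by (simp add: algebra_simps)
  qed simp
  \<comment> \<open>After \<open>n\<close> steps the walk is back at its start, the labels cancel
    and \<open>2 dvd int n\<close> remains.\<close>
  from this[of n] show ?thesis by (simp add: rim_def)
qed

lemma spoke_offset_neq_1_if_odd_circulant_labelling:
  assumes z: "circulant_labelling m S (accordion_graph n k) z"
    and "2 \<le> n" "even m" "\<And>s. s \<in> S \<Longrightarrow> odd s"
  shows "k \<noteq> 1"
proof
  assume "k = 1"
  then have arcs: "(U 1, V 1) \<in> parcs (accordion_graph n k)"
    "(V 1, V 2) \<in> parcs (accordion_graph n k)" "(U 1, V 2) \<in> parcs (accordion_graph n k)"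
    using assms by (simp_all add: accordion_arc_iff numeral_2_eq_2)
  have "2 dvd z q - z p - 1" if "(p, q) \<in> parcs (accordion_graph n k)"
    "p \<in> pverts (accordion_graph n k)" "q \<in> pverts (accordion_graph n k)" for p q
    by (rule circulant_labelling_arc_dvd[OF z]) (use assms that in auto)
  from this[OF arcs(1)] this[OF arcs(2)] this[OF arcs(3)] show False
    using assms(2) by simp
qed

lemma spoke_offset_le_2_if_odd_circulant_labelling:
  assumes z: "circulant_labelling (2 * n) S (accordion_graph n k) z"
    and "0 < n" "2 * k \<le> n" "\<And>s. s \<in> S \<Longrightarrow> odd s"
  shows "k \<le> 2"
proof (rule ccontr)
  let ?A = "accordion_graph n k"
  let ?w = "\<lambda>i. z (rim n i)"
  assume k: "\<not> k \<le> 2"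
  have "[?w (Suc (Suc i)) - ?w (Suc i) = ?w (Suc i) - ?w i] (mod int (2 * n))" for i
  proof -
    \<comment> \<open>\<open>p\<close> is reached from \<open>rim n i\<close> by taking the second
      step first; the first step then leads from \<open>p\<close> to
      \<open>rim n (Suc (Suc i))\<close>.\<close>
    obtain p where p: "p \<in> pverts ?A"
      "[z p = ?w i + (?w (Suc (Suc i)) - ?w (Suc i))] (mod int (2 * n))"
      using z unfolding circulant_labelling_def by blast
    then have p': "[z p - ?w i = ?w (Suc (Suc i)) - ?w (Suc i)] (mod int (2 * n))"
      "[?w (Suc (Suc i)) - z p = ?w (Suc i) - ?w i] (mod int (2 * n))"
      by (auto simp: cong_iff_dvd_diff algebra_simps dvd_diff_commute)
    have "(rim n i, p) \<in> parcs ?A" "(p, rim n (Suc (Suc i))) \<in> parcs ?A"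
      using circulant_labelling_arc_shift[OF z rim_arc _ _ _ _ p'(1)]
        circulant_labelling_arc_shift[OF z rim_arc _ _ _ _ p'(2)] p(1) \<open>0 < n\<close> by simp_all
    then have "p = rim n (Suc i)"
      unfolding rim_def by (intro accordion_rim_common_neighbour[of k n])
        (use k assms p(1) in \<open>auto simp: Suc_le_eq cong_def mod_simps\<close>)
    then show ?thesis using p' by (simp add: cong_sym)
  qed
  then have step: "[?w (Suc i) - ?w i = ?w 1 - ?w 0] (mod int (2 * n))" for i
    by (induction i) (auto intro: cong_trans)
  have "int (2 * n) dvd ?w i - ?w 0 - int i * (?w 1 - ?w 0)" for i
  proof (induction i)
    case (Suc i)
    from dvd_add[OF this step[of i, unfolded cong_iff_dvd_diff]]
    show ?case by (simp add: algebra_simps)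
  qed simp
  \<comment> \<open>The walk closes after \<open>n\<close> equal steps; cancelling \<open>n\<close>
    makes the step even, although every step is odd.\<close>
  from this[of n] have "int n * 2 dvd int n * (?w 1 - ?w 0)" by (simp add: rim_def mult.commute)
  then have "2 dvd ?w 1 - ?w 0" using \<open>0 < n\<close> by simp
  moreover have "2 dvd ?w 1 - ?w 0 - 1"
    by (rule circulant_labelling_arc_dvd[OF z]) (use assms rim_arc[of n 0 k] in auto)
  ultimately show False by presburger
qed

text \<open>Every arc changes the label by a multiple of \<open>d\<close>. As the accordion graph is
  connected, all labels agree modulo \<open>d\<close>; but some label is one more than that of
  \<open>rim n 0\<close> modulo \<open>m\<close>, hence modulo \<open>d\<close>, so \<open>d\<close>
  divides 1.\<close>

lemma common_divisor_circulant_labelling: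
  assumes z: "circulant_labelling m S (accordion_graph n k) z"
    and "0 < n" and d: "d dvd m" "\<And>s. s \<in> S \<Longrightarrow> d dvd s"
  shows "d = 1"
proof -
  let ?A = "accordion_graph n k"
  have arc: "int d dvd z q - z p" if "(p, q) \<in> parcs ?A" "p \<in> pverts ?A" "q \<in> pverts ?A" for p q
    using circulant_labelling_arc_dvd[OF z, of "int d" 0 p q] d that by simp
  have rim: "int d dvd z (rim n i) - z (rim n 0)" for i
  proof (induction i)
    case (Suc i)
    have "int d dvd z (rim n (Suc i)) - z (rim n i)" by (rule arc) (use \<open>0 < n\<close> rim_arc in auto)
    from dvd_add[OF Suc this] show ?case by simp
  qed simp
  have U: "int d dvd z (U i) - z (rim n 0)" if "i \<in> {1..n}" for i
    using rim[of "i - 1"] that by (auto simp: rim_def)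
  have V: "int d dvd z (V i) - z (rim n 0)" if "i \<in> {1..n}" for i
  proof -
    have "int d dvd z (V i) - z (U i)" by (rule arc) (use that accordion_arc_iff in auto)
    from dvd_add[OF U[OF that] this] show ?thesis by simp
  qed
  obtain p where p: "p \<in> pverts ?A" "[z p = z (rim n 0) + 1] (mod int m)"
    using z unfolding circulant_labelling_def by blast
  have "int d dvd z p - z (rim n 0)" using U V p(1) by (cases p) auto
  moreover have "int d dvd z p - (z (rim n 0) + 1)"
    using p(2) d(1) unfolding cong_iff_dvd_diff by (meson dvd_trans of_nat_dvd_iff)
  ultimately have "int d dvd (z p - z (rim n 0)) - (z p - (z (rim n 0) + 1))" by (rule dvd_diff)
  then show ?thesis by simp
qed

section \<open>Twin vertices for \<open>k = 2\<close>\<close>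

text \<open>Both vertices have the neighbours \<open>U 2\<close>, \<open>U n\<close>,
  \<open>V 1\<close> and \<open>V 3\<close>.\<close>

lemma accordion_twins:
  assumes "4 \<le> n" "p \<in> pverts (accordion_graph n 2)"
  shows "(U 1, p) \<in> parcs (accordion_graph n 2) \<longleftrightarrow> (V 2, p) \<in> parcs (accordion_graph n 2)"
proof (cases p)
  case (U j)
  have "[1 = j + 1] (mod n) \<longleftrightarrow> [2 = j + 2] (mod n)"
    using cong_add_rcancel_nat[of 1 1 "j + 1" n] by (simp add: numeral_2_eq_2)
  then show ?thesis using assms unfolding U by (auto simp: accordion_arc_iff numeral_2_eq_2 cong_sym_eq)
next
  case (V j)
  have "[2 = j + 1] (mod n) \<longleftrightarrow> [j = 1] (mod n)"
    using cong_add_rcancel_nat[of 1 1 j n] by (simp add: numeral_2_eq_2 cong_sym_eq)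
  then show ?thesis using assms unfolding V by (auto simp: accordion_arc_iff numeral_3_eq_3)
qed

text \<open>The label difference of the twins \<open>U 1\<close> and \<open>V 2\<close> is nonzero
  modulo \<open>2 * n\<close>. Steps from \<open>U 1\<close> lead to neighbours of
  \<open>V 2\<close>, so translation by this difference maps the connection set into itself.\<close>

lemma sum_eq_order_if_circulant_labelling:
  assumes z: "circulant_labelling (2 * n) {a, b} (accordion_graph n 2) z"
    and n: "4 \<le> n" and ab: "a \<noteq> b" "0 < a" "a < n" "0 < b" "b < n"
  shows "a + b = n"
proof -
  let ?A = "accordion_graph n 2"
  have ex: "\<exists>p\<in>pverts ?A. [z p = t] (mod int (2 * n))" for t
    using z unfolding circulant_labelling_def by blast
  have arc: "(p, q) \<in> parcs ?A \<longleftrightarrow> (\<exists>s\<in>{int a, - int a, int b, - int b}. 2 * int n dvd z q - z p - s)"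
    if "p \<in> pverts ?A" "q \<in> pverts ?A" for p q
    using z that unfolding circulant_labelling_def cong_iff_dvd_diff by auto
  have v: "U 1 \<in> pverts ?A" "V 2 \<in> pverts ?A" using n by auto
  have "int a + int b = int n"
  proof (rule connection_set_translate)
    show "\<not> 2 * int n dvd z (U 1) - z (V 2)"
      using z v unfolding circulant_labelling_def
      by (metis accordion_vertex.distinct(1) cong_iff_dvd_diff cong_refl of_nat_mult of_nat_numeral)
    show "\<exists>s\<in>{int a, - int a, int b, - int b}. 2 * int n dvd c + (z (U 1) - z (V 2)) - s"
      if c: "c \<in> {int a, - int a, int b, - int b}" for c
    proof -
      obtain p where p: "p \<in> pverts ?A" "2 * int n dvd z p - (z (U 1) + c)"
        using ex[of "z (U 1) + c"] by (auto simp: cong_iff_dvd_diff)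
      then have "(U 1, p) \<in> parcs ?A" using arc[OF v(1) p(1)] c by (auto simp: algebra_simps)
      then obtain s where s: "s \<in> {int a, - int a, int b, - int b}" "2 * int n dvd z p - z (V 2) - s"
        using accordion_twins[OF n p(1)] arc[OF v(2) p(1)] by blast
      have "2 * int n dvd (z p - z (V 2) - s) - (z p - (z (U 1) + c))"
        using s(2) p(2) by (rule dvd_diff)
      then show ?thesis using s(1) by (intro bexI[of _ s]) (simp_all add: algebra_simps)
    qed
  qed (use ab in auto)
  then show ?thesis by linarith
qed

section \<open>Construction of a labelling for \<open>k = 2\<close>\<close>

text \<open>Twins receive values differing by \<open>n\<close>; hence \<open>u\<^sub>n\<close>, the twin of \<open>v\<^sub>1\<close>, has value 0.\<close>

primrec twin_index :: "nat \<Rightarrow> accordion_vertex \<Rightarrow> nat" where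
  "twin_index n (U i) = i mod n"
| "twin_index n (V i) = n + (i - 1)"

lemma bij_betw_twin_index:
  assumes "0 < n"
  shows "bij_betw (twin_index n) (pverts (accordion_graph n k)) {..<2 * n}"
proof (rule bij_betw_imageI)
  have mod: "i mod n = (if i = n then 0 else i)" if "i \<le> n" for i using that by auto
  show "inj_on (twin_index n) (pverts (accordion_graph n k))"
  proof (rule inj_onI)
    fix p q assume *: "p \<in> pverts (accordion_graph n k)" "q \<in> pverts (accordion_graph n k)"
      "twin_index n p = twin_index n q"
    then show "p = q" using assms by (cases p; cases q) (auto simp: mod split: if_splits)
  qed
  show "twin_index n ` pverts (accordion_graph n k) = {..<2 * n}"
  proof (intro equalityI subsetI)
    fix x assume "x \<in> twin_index n ` pverts (accordion_graph n k)"
    then obtain p where p: "p \<in> pverts (accordion_graph n k)" "x = twin_index n p" by blast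
    then show "x \<in> {..<2 * n}"
      using assms by (cases p) (auto simp: mod)
  next
    fix x assume x: "x \<in> {..<2 * n}"
    have "\<exists>p\<in>pverts (accordion_graph n k). twin_index n p = x"
    proof (cases "x < n")
      case True
      then show ?thesis using assms by (intro bexI[of _ "U (if x = 0 then n else x)"]) auto
    next
      case False
      then show ?thesis using x by (intro bexI[of _ "V (x - n + 1)"]) auto
    qed
    then show "x \<in> twin_index n ` pverts (accordion_graph n k)" by blast
  qed
qed

text \<open>Modulo \<open>n\<close> the index forgets which twin is meant, and the graph becomes an
  \<open>n\<close>-cycle with doubled vertices. The spokes from \<open>U i\<close> to
  \<open>V i\<close> and \<open>V (i + 2)\<close> are its steps -1 and +1.\<close>

lemma twin_index_arc_iff:
  assumes "p \<in> pverts (accordion_graph n 2)" "q \<in> pverts (accordion_graph n 2)"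
  shows "(p, q) \<in> parcs (accordion_graph n 2) \<longleftrightarrow>
    int n dvd int (twin_index n q) - int (twin_index n p) - 1 \<or>
    int n dvd int (twin_index n q) - int (twin_index n p) + 1"
proof -
  \<comment> \<open>The value of \<open>twin_index\<close> modulo \<open>n\<close>, over the
    integers and free of \<open>mod\<close> and truncated subtraction.\<close>
  let ?c = "case_accordion_vertex int (\<lambda>i. int i - 1)"
  have "int n dvd int (twin_index n p) - ?c p" if "p \<in> pverts (accordion_graph n 2)" for p
    using that by (cases p) (auto simp: of_nat_mod of_nat_diff simp flip: mod_eq_dvd_iff)
  then have d: "int n dvd (int (twin_index n q) - ?c q) - (int (twin_index n p) - ?c p)"
    using assms by (blast intro: dvd_diff)
  have "int n dvd int (twin_index n q) - int (twin_index n p) + t \<longleftrightarrow> int n dvd ?c q - ?c p + t" for t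
    using dvd_add_right_iff[OF d, of "?c q - ?c p + t"] by (simp add: algebra_simps)
  from this[of 1] this[of "-1"] show ?thesis
    using assms by (cases p; cases q)
      (auto simp: accordion_arc_iff cong_nat_iff_dvd_int algebra_simps dvd_diff_commute)
qed

lemma dvd_int_double:
  fixes n t :: int
  shows "n dvd t \<longleftrightarrow> 2 * n dvd t \<or> 2 * n dvd t - n"
proof
  assume "n dvd t"
  then obtain c where c: "t = n * c" by blast
  show "2 * n dvd t \<or> 2 * n dvd t - n"
  proof (cases "even c")
    case True
    then show ?thesis using c by (auto elim!: evenE)
  next
    case False
    then show ?thesis using c by (auto elim!: oddE simp: algebra_simps)
  qed
next
  assume "2 * n dvd t \<or> 2 * n dvd t - n"
  then show "n dvd t"
    by (metis dvd_add_left_iff dvd_mult_right dvd_refl diff_add_cancel)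
qed

text \<open>Multiplication by the unit \<open>a\<close> permutes the residues modulo
  \<open>2 * n\<close> and turns the steps \<plusminus>1 modulo \<open>n\<close> into
  \<plusminus>\<open>a\<close> modulo \<open>n\<close>.\<close>

lemma accordion_circulant_labelling:
  assumes "0 < n" "coprime a (2 * n)" and ab: "a + b = n"
  shows "circulant_labelling (2 * n) {a, b} (accordion_graph n 2) (\<lambda>p. int (a * twin_index n p))"
proof -
  let ?A = "accordion_graph n 2"
  let ?z = "\<lambda>p. int (a * twin_index n p)"
  have c2: "coprime (int (2 * n)) (int a)" and c1: "coprime (int n) (int a)"
    using assms(2) by (simp_all add: coprime_commute del: of_nat_mult)
  have z: "?z q - ?z p = int a * (int (twin_index n q) - int (twin_index n p))" for p q
    by (simp add: algebra_simps)
  have bij: "bij_betw (twin_index n) (pverts ?A) {..<2 * n}"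
    using \<open>0 < n\<close> by (rule bij_betw_twin_index)
  have "\<exists>!p. p \<in> pverts ?A \<and> [?z p = t] (mod int (2 * n))" for t
  proof (rule ex_ex1I)
    obtain x where x: "[int a * x = t] (mod int (2 * n))"
      using cong_solve_coprime_int[of "int a" "int (2 * n)"] c2
      by (metis cong_scalar_right coprime_commute mult.assoc mult_1)
    let ?r = "nat (x mod int (2 * n))"
    have "?r < 2 * n" using \<open>0 < n\<close> by (simp add: nat_less_iff)
    then obtain p where p: "p \<in> pverts ?A" "twin_index n p = ?r"
      using bij_betw_imp_surj_on[OF bij] by (metis (lifting) imageE lessThan_iff)
    have "[int a * (x mod int (2 * n)) = int a * x] (mod int (2 * n))"
      by (simp add: cong_def mod_mult_right_eq)
    moreover have "?z p = int a * (x mod int (2 * n))" using p \<open>0 < n\<close> by simp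
    ultimately have "[?z p = t] (mod int (2 * n))" using x by (metis cong_trans)
    then show "\<exists>p. p \<in> pverts ?A \<and> [?z p = t] (mod int (2 * n))" using p(1) by blast
  next
    fix p q
    assume *: "p \<in> pverts ?A \<and> [?z p = t] (mod int (2 * n))" "q \<in> pverts ?A \<and> [?z q = t] (mod int (2 * n))"
    then have "[?z q = ?z p] (mod int (2 * n))" by (blast intro: cong_trans cong_sym)
    then have "int (2 * n) dvd int (twin_index n q) - int (twin_index n p)"
      unfolding cong_iff_dvd_diff z using c2 coprime_dvd_mult_right_iff by blast
    then have "[twin_index n q = twin_index n p] (mod (2 * n))" by (simp only: cong_nat_iff_dvd_int)
    moreover have "twin_index n p < 2 * n" "twin_index n q < 2 * n"
      using * bij_betw_apply[OF bij] by auto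
    ultimately have "twin_index n q = twin_index n p" by (simp add: cong_def)
    then show "p = q" using * bij_betw_imp_inj_on[OF bij] by (blast dest: inj_onD)
  qed
  moreover have "(p, q) \<in> parcs ?A \<longleftrightarrow> (\<exists>s\<in>{a, b}. [?z q - ?z p = int s] (mod int (2 * n)) \<or>
      [?z q - ?z p = - int s] (mod int (2 * n)))" if "p \<in> pverts ?A" "q \<in> pverts ?A" for p q
  proof -
    let ?d = "int (twin_index n q) - int (twin_index n p)"
    have b: "int b = int n - int a" using ab by simp
    have per: "2 * int n dvd t + int n \<longleftrightarrow> 2 * int n dvd t - int n" for t
      using dvd_add_right_iff[of "2 * int n" "2 * int n" "t - int n"] by (simp add: algebra_simps)
    have "(p, q) \<in> parcs ?A \<longleftrightarrow> int n dvd ?d - 1 \<or> int n dvd ?d + 1"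
      by (rule twin_index_arc_iff[OF that])
    also have "\<dots> \<longleftrightarrow> int n dvd int a * (?d - 1) \<or> int n dvd int a * (?d + 1)"
      using c1 by (simp add: coprime_dvd_mult_right_iff)
    also have "\<dots> \<longleftrightarrow> int n dvd (?z q - ?z p) - int a \<or> int n dvd (?z q - ?z p) + int a"
      unfolding z by (simp add: algebra_simps)
    \<comment> \<open>A residue modulo \<open>n\<close> splits into two modulo \<open>2 * n\<close>:
      since \<open>a + b = n\<close>, the class of \<open>a\<close> splits into \<open>a\<close> and
      \<open>-b\<close>, that of \<open>-a\<close> into \<open>-a\<close> and
      \<open>b\<close>.\<close>
    also have "\<dots> \<longleftrightarrow> 2 * int n dvd (?z q - ?z p) - int a \<or> 2 * int n dvd (?z q - ?z p) + int b \<or>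
        2 * int n dvd (?z q - ?z p) + int a \<or> 2 * int n dvd (?z q - ?z p) - int b"
      using dvd_int_double[of "int n" "(?z q - ?z p) - int a"]
        dvd_int_double[of "int n" "(?z q - ?z p) + int a"] per[of "(?z q - ?z p) - int a"]
      unfolding b by (simp add: algebra_simps)
    finally show ?thesis by (auto simp: cong_iff_dvd_diff)
  qed
  ultimately show ?thesis unfolding circulant_labelling_def by blast
qed

section \<open>Necessity and sufficiency of the three conditions\<close>

theorem theorem2p5:
  fixes n k a b :: nat
  assumes "n \<ge> 3"
    and "1 \<le> k" and "real k \<le> real n / 2"
    and "odd a" and "odd b" and "a \<noteq> b"
    and "0 < a" and "a < n" and "0 < b" and "b < n"
  shows "digraph_iso (with_proj (circulant_graph (2 * n) {a, b}))
                     (with_proj (accordion_graph n k)) \<longleftrightarrow>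
         (even n \<and> k = 2) \<and>
         (gcd (2 * n) a = 1 \<and> gcd (2 * n) b = 1) \<and>
         a + b = n"
    (is "?iso \<longleftrightarrow> ?R")
proof -
  interpret A: pair_graph "accordion_graph n k"
    by (rule pair_graph_accordion_graph) (use assms in simp)
  have iso: "?iso \<longleftrightarrow> (\<exists>z. circulant_labelling (2 * n) {a, b} (accordion_graph n k) z)"
    by (rule digraph_iso_circulant_iff[OF A.pair_wf_digraph_axioms]) (use assms in auto)
  show ?thesis
  proof
    assume ?iso
    then obtain z where z: "circulant_labelling (2 * n) {a, b} (accordion_graph n k) z"
      using iso by blast
    have "k \<noteq> 1" by (rule spoke_offset_neq_1_if_odd_circulant_labelling[OF z]) (use assms in auto)
    moreover have "k \<le> 2" by (rule spoke_offset_le_2_if_odd_circulant_labelling[OF z]) (use assms in auto)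
    ultimately have k: "k = 2" using assms by linarith
    have n: "even n" by (rule even_order_if_odd_circulant_labelling[OF z]) (use assms in auto)
    then have "4 \<le> n" using assms(1) by presburger
    then have sum: "a + b = n"
      using sum_eq_order_if_circulant_labelling z assms unfolding k by blast
    have "gcd (2 * n) c = 1" if c: "odd c" "c \<in> {a, b}" for c
    proof (rule common_divisor_circulant_labelling[OF z])
      \<comment> \<open>The gcd is odd because it divides \<open>c\<close>, so it divides
        \<open>n = a + b\<close>; with \<open>c\<close> it then divides the other of
        \<open>a\<close> and \<open>b\<close>, and is a common divisor of all steps.\<close>
      have "coprime (gcd (2 * n) c) 2"
        using c(1) by (meson coprime_commute coprime_left_2_iff_odd dvd_trans gcd_dvd2)
      then have "gcd (2 * n) c dvd n" using coprime_dvd_mult_right_iff by blast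
      then show "gcd (2 * n) c dvd s" if "s \<in> {a, b}" for s
        using that c(2) sum
        by (metis dvd_add_right_iff dvd_add_left_iff gcd_dvd2 insertE singletonD)
    qed (use assms in auto)
    then show ?R using n k sum assms by blast
  next
    assume R: ?R
    then have "coprime a (2 * n)" by (simp add: coprime_iff_gcd_eq_1 gcd.commute)
    then show ?iso using iso accordion_circulant_labelling[of n a b] R assms(1) by auto
  qed
qed

end
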